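(* Let $n \in \mathbb{N}$, let $\eta(\boldsymbol{x}) = \sum_{i=1}^n \eta_i(x_i)$ be a scale function on $\mathbb{R}^n$, let $\beta \in \mathbb{R}$, and let $\mathcal{F} = \{\boldsymbol{x} \in \prod_{i=1}^n [\ell^i, u^i] \mid \eta(\boldsymbol{x}) \leq \beta\}$, where the variable domains $[\ell^i,u^i]$ are not required to be bounded. For each $i \in [n]$ let $[\ell^i_j, u^i_j]$, $j \in L_i$, be domain partitioning sub-intervals with $\bigcup_{j \in L_i} [\ell^i_j,u^i_j] = [\ell^i,u^i]$. Let $\mathcal{D}$ be the decision diagram constructed by the DD construction algorithm (given in the context) from $\mathcal{F}$ and these sub-intervals. Then $\operatorname{conv}(\mathcal{F}) \subseteq \operatorname{conv}(\operatorname{Sol}(\mathcal{D}))$.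
   Context: Notation: $[n] = \{1,\dots,n\}$; $\operatorname{conv}$ denotes convex hull. Intervals $[\ell,u]$ are nonempty subsets of $\mathbb{R}$ with $\ell \le u$; the endpoints $\ell = -\infty$ and $u = +\infty$ are allowed (so $[\ell,u]$ may be a half-line or all of $\mathbb{R}$). Definition (scale function). A scale function is a function $\eta:\mathbb{R}^n \to \mathbb{R}_+$ of the form $\eta(\boldsymbol{x}) = \sum_{i=1}^n \eta_i(x_i)$, where each $\eta_i:\mathbb{R} \to \mathbb{R}_+ = [0,\infty)$ satisfies: (i) $\eta_i(x) = 0$ if and only if $x = 0$; (ii) $\eta_i(x_1) \leq \eta_i(x_2)$ whenever $0 \leq x_1 \leq x_2$; (iii) $\eta_i(x_1) \geq \eta_i(x_2)$ whenever $x_1 \leq x_2 \leq 0$. Definition (decision diagram, DD). A DD $\mathcal{D} = (\mathcal{U},\mathcal{A},l)$ is a directed acyclic (multi)graph with node layers $\mathcal{U}_1,\dots,\mathcal{U}_{n+1}$, where $\mathcal{U}_1 = \{r\}$ (root) and $\mathcal{U}_{n+1} = \{t\}$ (terminal), arc layers $\mathcal{A}_1,\dots,\mathcal{A}_n$, where each arc in $\mathcal{A}_i$ goes from a node of $\mathcal{U}_i$ to a node of $\mathcal{U}_{i+1}$ (parallel arcs are allowed), and an arc label map $l$ on $\mathcal{A}$ (real-valued, except that a label may be $\pm\infty$ when a variable domain is unbounded). An $r$-$t$ path $(a_1,\dots,a_n) \in \mathcal{A}_1 \times \dots \times \mathcal{A}_n$ encodes the point $(l(a_1),\dots,l(a_n))$.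 $\operatorname{Sol}(\mathcal{D})$ is the set of points encoded by all $r$-$t$ paths (empty if there are none). DD construction algorithm. Input: $\mathcal{F} = \{\boldsymbol{x} \in \prod_{i=1}^n [\ell^i,u^i] \mid \eta(\boldsymbol{x}) \leq \beta\}$, and for each $i \in [n]$ an index set $L_i$ of sub-intervals $[\ell^i_j,u^i_j]$, $j \in L_i$, whose union is $[\ell^i,u^i]$. For $i \in [n]$, $j \in L_i$, put $$c^i_j = \begin{cases} \eta_i(u^i_j) & \text{if } u^i_j \leq 0,\\ \eta_i(\ell^i_j) & \text{else if } \ell^i_j \geq 0,\\ 0 & \text{otherwise.}\end{cases}$$ (This is always finite, even if an endpoint is infinite.) 1. Create the root $r$ in $\mathcal{U}_1$ with state value $s(r) = 0$ and the terminal $t$ in $\mathcal{U}_{n+1}$. 2. For $i = 1,\dots,n-1$ in order, for every $u \in \mathcal{U}_i$ and $j \in L_i$: create a node $v$ in $\mathcal{U}_{i+1}$ with state value $s(v) = s(u) + c^i_j$, if no node with this state value exists in $\mathcal{U}_{i+1}$ (otherwise let $v$ be that existing node), and add two arcs from $u$ to $v$ with labels $\ell^i_j$ and $u^i_j$. 3. For every $u \in \mathcal{U}_n$ and $j \in L_n$: compute $\bar s = s(u) + c^n_j$; if $\bar s \leq \beta$, add two arcs from $u$ to $t$ with labels $\ell^n_j$ and $u^n_j$. Convention for infinite labels. Each $r$-$t$ path uses, in each arc layer $i$, one arc of a pair created for some sub-interval index $j_i \in L_i$; the $2^n$ paths obtained by choosing either arc of each pair encode the vertices of the box $\prod_{i=1}^n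 [\ell^i_{j_i},u^i_{j_i}]$. $\operatorname{conv}(\operatorname{Sol}(\mathcal{D}))$ is the convex hull in $\mathbb{R}^n$ of the union of all such boxes. If all endpoints are real, this is exactly the usual convex hull of the set $\operatorname{Sol}(\mathcal{D}) \subseteq \mathbb{R}^n$. *)

theory Defs
  imports "HOL-Analysis.Analysis"
begin

definition real_interval :: "ereal \<Rightarrow> ereal \<Rightarrow> real set"
  where "real_interval l u = {x. l \<le> ereal x \<and> ereal x \<le> u}"

text \<open>The last two conditions exclude \<open>l = u = \<infinity>\<close> and \<open>l = u = -\<infinity>\<close>, where the subset of
  the reals would be empty.\<close>

definition proper_interval :: "ereal \<Rightarrow> ereal \<Rightarrow> bool"
  where "proper_interval l u \<longleftrightarrow> l \<le> u \<and> l \<noteq> \<infinity> \<and> u \<noteq> -\<infinity>"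

definition scale_component :: "(real \<Rightarrow> real) \<Rightarrow> bool"
  where "scale_component h \<longleftrightarrow>
    (\<forall>x. 0 \<le> h x) \<and>
    (\<forall>x. h x = 0 \<longleftrightarrow> x = 0) \<and>
    (\<forall>x y. 0 \<le> x \<and> x \<le> y \<longrightarrow> h x \<le> h y) \<and>
    (\<forall>x y. x \<le> y \<and> y \<le> 0 \<longrightarrow> h y \<le> h x)"

text \<open>Points of \<open>\<real>\<^sup>n\<close> are vectors of type \<^typ>\<open>real^'n\<close> with \<open>n = CARD('n)\<close>. The index type
  carries no order, so a bijection \<open>pos\<close> from \<^typ>\<open>'n\<close> onto \<open>{1..n}\<close> says which coordinate is
  the first, the second, and so on. All data attached to the coordinates (component functions,
  intervals, diagram layers) are indexed by \<open>1, \<dots>, n\<close>.\<close>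

definition scale_function ::
    "('n \<Rightarrow> nat) \<Rightarrow> (nat \<Rightarrow> real \<Rightarrow> real) \<Rightarrow> (real^'n \<Rightarrow> real) \<Rightarrow> bool"
  where "scale_function pos h \<eta> \<longleftrightarrow>
    (\<forall>i\<in>{1..CARD('n)}. scale_component (h i)) \<and>
    (\<forall>x. \<eta> x = (\<Sum>k\<in>UNIV. h (pos k) (x $ k)))"

definition feasible_set ::
    "('n \<Rightarrow> nat) \<Rightarrow> (real^'n \<Rightarrow> real) \<Rightarrow> real \<Rightarrow> (nat \<Rightarrow> ereal) \<Rightarrow> (nat \<Rightarrow> ereal) \<Rightarrow> (real^'n) set"
  where "feasible_set pos \<eta> \<beta> l u =
    {x. (\<forall>k. x $ k \<in> real_interval (l (pos k)) (u (pos k))) \<and> \<eta> x \<le> \<beta>}"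

record ('v, 'a) diagram =
  nodes :: "nat \<Rightarrow> 'v set"
  arcs :: "nat \<Rightarrow> 'a set"
  src :: "'a \<Rightarrow> 'v"
  tgt :: "'a \<Rightarrow> 'v"
  lab :: "'a \<Rightarrow> ereal"

text \<open>Acyclicity needs no separate condition: arcs only lead from a layer to the next one, and
  distinct layers are disjoint.\<close>

definition decision_diagram :: "nat \<Rightarrow> ('v, 'a) diagram \<Rightarrow> bool"
  where "decision_diagram n D \<longleftrightarrow>
    (\<exists>r. nodes D 1 = {r}) \<and> (\<exists>t. nodes D (n + 1) = {t}) \<and>
    disjoint_family_on (nodes D) {1..n + 1} \<and>
    (\<forall>i\<in>{1..n}. \<forall>a\<in>arcs D i. src D a \<in> nodes D i \<and> tgt D a \<in> nodes D (i + 1))"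

text \<open>Since the first and the last node layer are singletons, every such sequence of arcs leads
  from the root to the terminal.\<close>

definition rt_paths :: "nat \<Rightarrow> ('v, 'a) diagram \<Rightarrow> (nat \<Rightarrow> 'a) set"
  where "rt_paths n D =
    {p \<in> (\<Pi>\<^sub>E i\<in>{1..n}. arcs D i). \<forall>i\<in>{1..<n}. tgt D (p i) = src D (p (i + 1))}"

definition Sol :: "('n \<Rightarrow> nat) \<Rightarrow> ('v, 'a) diagram \<Rightarrow> (ereal^'n) set"
  where "Sol pos D = (\<lambda>p. \<chi> k. lab D (p (pos k))) ` rt_paths CARD('n) D"

text \<open>Within a layer, nodes are determined by their state value, so a node other than the
  terminal is given by its layer and its state value.\<close>

datatype node = State (layer: nat) (state: real) | Terminal

text \<open>The two arcs created for a node \<open>v\<close> and an index \<open>j\<close> are \<open>Arc v j Lower\<close> and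
  \<open>Arc v j Upper\<close>. They are distinct even if their labels coincide.\<close>

datatype endpoint = Lower | Upper

datatype 'j arc = Arc (tail: node) (index: 'j) (endpoint: endpoint)

definition interval_cost :: "(real \<Rightarrow> real) \<Rightarrow> ereal \<Rightarrow> ereal \<Rightarrow> real"
  where "interval_cost h l u =
    (if u \<le> 0 then h (real_of_ereal u) else if 0 \<le> l then h (real_of_ereal l) else 0)"

text \<open>\<open>reached L c i s\<close> holds if a node with state value \<open>s\<close> is created in layer \<open>i\<close>. The relation
  does not stop at layer \<open>n\<close>; only its part for \<open>i \<le> n\<close> enters the diagram.\<close>

inductive reached :: "(nat \<Rightarrow> 'j set) \<Rightarrow> (nat \<Rightarrow> 'j \<Rightarrow> real) \<Rightarrow> nat \<Rightarrow> real \<Rightarrow> bool"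
  for L :: "nat \<Rightarrow> 'j set" and c :: "nat \<Rightarrow> 'j \<Rightarrow> real"
  where
    root: "reached L c 1 0"
  | step: "reached L c i s \<Longrightarrow> j \<in> L i \<Longrightarrow> reached L c (i + 1) (s + c i j)"

definition build_diagram ::
    "nat \<Rightarrow> (nat \<Rightarrow> real \<Rightarrow> real) \<Rightarrow> real \<Rightarrow> (nat \<Rightarrow> 'j set) \<Rightarrow>
     (nat \<Rightarrow> 'j \<Rightarrow> ereal) \<Rightarrow> (nat \<Rightarrow> 'j \<Rightarrow> ereal) \<Rightarrow> (node, 'j arc) diagram"
  where "build_diagram n h \<beta> L lo up =
    (let c = (\<lambda>i j. interval_cost (h i) (lo i j) (up i j));
         U = (\<lambda>i. if i \<le> n then {State i s | s. reached L c i s}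
                  else if i = n + 1 then {Terminal} else {})
     in \<lparr> nodes = U,
          arcs = (\<lambda>i. {Arc v j e | v j e.
                         i \<le> n \<and> v \<in> U i \<and> j \<in> L i \<and> (i = n \<longrightarrow> state v + c n j \<le> \<beta>)}),
          src = tail,
          tgt = (\<lambda>a. let i = layer (tail a) in
                   if i = n then Terminal else State (i + 1) (state (tail a) + c i (index a))),
          lab = (\<lambda>a. let i = layer (tail a) in
                   case endpoint a of Lower \<Rightarrow> lo i (index a) | Upper \<Rightarrow> up i (index a)) \<rparr>)"

lemma reached_first: "reached L c (Suc 0) s \<longleftrightarrow> s = 0"
proof -
  have "reached L c i s \<Longrightarrow> 1 \<le> i \<and> (i = 1 \<longrightarrow> s = 0)" for i
    by (induction rule: reached.induct) auto
  then show ?thesis using reached.root[of L c] by auto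
qed

lemma decision_diagram_build:
  assumes "1 \<le> n"
  shows "decision_diagram n (build_diagram n h \<beta> L lo up)"
proof -
  have "disjoint_family_on (nodes (build_diagram n h \<beta> L lo up)) {1..n + 1}"
    by (auto simp: build_diagram_def disjoint_family_on_def Let_def split: if_splits)
  then show ?thesis
    using assms reached.step
    by (fastforce simp: decision_diagram_def build_diagram_def Let_def reached_first)
qed

text \<open>Labels may be infinite, so the convex hull is not taken of \<^const>\<open>Sol\<close> itself. Replacing
  arcs of a path by the other arc of their pair yields \<open>2\<^sup>n\<close> paths, which encode the vertices
  of a possibly unbounded box, and the hull is taken of the union of these boxes. For finite
  labels this is the usual convex hull, see \<open>conv_Sol_finite\<close> below.\<close>

definition path_box ::
    "('n \<Rightarrow> nat) \<Rightarrow> ('v, 'j arc) diagram \<Rightarrow> (nat \<Rightarrow> 'j arc) \<Rightarrow> (real^'n) set"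
  where "path_box pos D p =
    {x. \<forall>k. let a = p (pos k) in
          x $ k \<in> real_interval (lab D (Arc (tail a) (index a) Lower))
                                (lab D (Arc (tail a) (index a) Upper))}"

definition conv_Sol :: "('n \<Rightarrow> nat) \<Rightarrow> ('v, 'j arc) diagram \<Rightarrow> (real^'n) set"
  where "conv_Sol pos D = convex hull (\<Union>p\<in>rt_paths CARD('n) D. path_box pos D p)"

lemma cbox_eq_hull_vertices:
  fixes a b :: "real^'n"
  assumes "\<And>k. a $ k \<le> b $ k"
  shows "cbox a b = convex hull {x. \<forall>k. x $ k = a $ k \<or> x $ k = b $ k}"
proof -
  define f where "f = (\<lambda>t :: real^'n. \<chi> k. t $ k * (b $ k - a $ k))"
  have lin: "linear f"
    by (rule linearI) (auto simp: f_def vec_eq_iff algebra_simps)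
  have unit: "cbox (0 :: real^'n) 1 = convex hull {x. \<forall>k. x $ k = 0 \<or> x $ k = 1}"
    using unit_interval_convex_hull[where 'a = "real^'n"]
    by (simp add: Basis_vec_def inner_axis Cart_1)
  have "cbox a b \<subseteq> (+) a ` f ` cbox 0 1"
  proof
    fix x assume x: "x \<in> cbox a b"
    define t :: "real^'n" where "t = (\<chi> k. (x $ k - a $ k) / (b $ k - a $ k))"
    have "t \<in> cbox 0 1"
      using x assms by (auto simp: t_def mem_box_cart divide_le_eq_1 zero_le_divide_iff)
        (smt (verit) assms)+
    moreover have "(x $ k - a $ k) / (b $ k - a $ k) * (b $ k - a $ k) = x $ k - a $ k" for k
      using x by (cases "a $ k = b $ k") (auto simp: mem_box_cart dest: spec[of _ k])
    then have "x = a + f t"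
      by (simp add: f_def t_def vec_eq_iff)
    ultimately show "x \<in> (+) a ` f ` cbox 0 1" by blast
  qed
  also have "\<dots> = convex hull ((+) a ` f ` {x. \<forall>k. x $ k = 0 \<or> x $ k = 1})"
    by (simp add: unit convex_hull_linear_image[OF lin]
        convex_hull_translation)
  also have "\<dots> \<subseteq> convex hull {x. \<forall>k. x $ k = a $ k \<or> x $ k = b $ k}"
  proof (rule hull_mono, clarify)
    fix t :: "real^'n" and k
    assume "\<forall>k. t $ k = 0 \<or> t $ k = 1" "(a + f t) $ k \<noteq> b $ k"
    then show "(a + f t) $ k = a $ k"
      by (cases "t $ k = 0") (auto simp: f_def)
  qed
  finally have 1: "cbox a b \<subseteq> convex hull {x. \<forall>k. x $ k = a $ k \<or> x $ k = b $ k}" .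
  have 2: "convex hull {x. \<forall>k. x $ k = a $ k \<or> x $ k = b $ k} \<subseteq> cbox a b"
  proof (rule hull_minimal)
    show "{x. \<forall>k. x $ k = a $ k \<or> x $ k = b $ k} \<subseteq> cbox a b"
      using assms by (auto simp: mem_box_cart) (metis order_refl)+
  qed (rule convex_box)
  from 1 2 show ?thesis by blast
qed

lemma conv_Sol_finite:
  fixes pos :: "'n::finite \<Rightarrow> nat"
    and h :: "nat \<Rightarrow> real \<Rightarrow> real" and \<beta> :: real
  assumes pos: "bij_betw pos UNIV {1..CARD('n)}"
    and fin: "\<And>i j. i \<in> {1..CARD('n)} \<Longrightarrow> j \<in> L i \<Longrightarrow>
                \<exists>a b. lo i j = ereal a \<and> up i j = ereal b \<and> a \<le> b"
  defines "D \<equiv> build_diagram CARD('n) h \<beta> L lo up"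
  shows "conv_Sol pos D = convex hull {x. (\<chi> k. ereal (x $ k)) \<in> Sol pos D}"
proof (rule antisym)
  have rng: "pos k \<in> {1..CARD('n)}" for k
    using pos by (auto simp: bij_betw_def)
  have inv: "inv pos (pos k) = k" for k
    using pos by (auto simp: bij_betw_def)
  have ends: "\<exists>a b. lab D (Arc (tail c) (index c) Lower) = ereal a \<and>
      lab D (Arc (tail c) (index c) Upper) = ereal b \<and> a \<le> b \<and>
      lab D c \<in> {ereal a, ereal b}"
    if "p \<in> rt_paths CARD('n) D" "c = p (pos k)" for p k c
  proof -
    have "c \<in> arcs D (pos k)"
      using that rng[of k] by (auto simp: rt_paths_def PiE_def Pi_def)
    then obtain s j e where "c = Arc (State (pos k) s) j e" "j \<in> L (pos k)"
      by (auto simp: D_def build_diagram_def Let_def)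
    then show ?thesis
      using fin[OF rng, of j k] by (cases e) (auto simp: D_def build_diagram_def Let_def)
  qed
  show "conv_Sol pos D \<subseteq> convex hull {x. (\<chi> k. ereal (x $ k)) \<in> Sol pos D}"
    unfolding conv_Sol_def
  proof (rule hull_minimal; clarify?)
    fix p and x :: "real^'n"
    assume p: "p \<in> rt_paths CARD('n) D" and x: "x \<in> path_box pos D p"
    let ?L = "\<lambda>k. lab D (Arc (tail (p (pos k))) (index (p (pos k))) Lower)"
    let ?U = "\<lambda>k. lab D (Arc (tail (p (pos k))) (index (p (pos k))) Upper)"
    obtain a b where ab: "\<And>k. ?L k = ereal (a k)" "\<And>k. ?U k = ereal (b k)" "\<And>k. a k \<le> b k"
      using ends[OF p refl] by metis
    let ?a = "\<chi> k. a k" and ?b = "\<chi> k. b k"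
    have "x \<in> cbox ?a ?b"
      using x ab by (simp add: path_box_def Let_def real_interval_def mem_box_cart)
    also have "\<dots> = convex hull {x. \<forall>k. x $ k = ?a $ k \<or> x $ k = ?b $ k}"
      by (rule cbox_eq_hull_vertices) (simp add: ab)
    also have "\<dots> \<subseteq> convex hull {x. (\<chi> k. ereal (x $ k)) \<in> Sol pos D}"
    proof (rule hull_mono, clarify)
      fix v :: "real^'n"
      assume v: "\<forall>k. v $ k = ?a $ k \<or> v $ k = ?b $ k"
      define q where "q = (\<lambda>i\<in>{1..CARD('n)}. Arc (tail (p i)) (index (p i))
        (if v $ inv pos i = a (inv pos i) then Lower else Upper))"
      have "q \<in> rt_paths CARD('n) D"
        using p by (fastforce simp: q_def rt_paths_def D_def build_diagram_def Let_def PiE_iff)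
      moreover have "lab D (q (pos k)) = ereal (v $ k)" for k
        using v[rule_format, of k] ab rng[of k] by (auto simp: q_def inv)
      ultimately show "(\<chi> k. ereal (v $ k)) \<in> Sol pos D"
        by (auto simp: Sol_def image_iff vec_eq_iff intro!: bexI[of _ q])
    qed
    finally show "x \<in> convex hull {x. (\<chi> k. ereal (x $ k)) \<in> Sol pos D}" .
  qed
  show "convex hull {x. (\<chi> k. ereal (x $ k)) \<in> Sol pos D} \<subseteq> conv_Sol pos D"
    unfolding conv_Sol_def
  proof (rule hull_mono, clarify)
    fix x :: "real^'n"
    assume "(\<chi> k. ereal (x $ k)) \<in> Sol pos D"
    then obtain p where p: "p \<in> rt_paths CARD('n) D" "\<And>k. ereal (x $ k) = lab D (p (pos k))"
      by (auto simp: Sol_def vec_eq_iff)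
    have "x \<in> path_box pos D p"
      unfolding path_box_def
    proof (clarsimp simp: Let_def real_interval_def)
      fix k
      show "lab D (Arc (tail (p (pos k))) (index (p (pos k))) Lower) \<le> ereal (x $ k) \<and>
        ereal (x $ k) \<le> lab D (Arc (tail (p (pos k))) (index (p (pos k))) Upper)"
        using ends[OF p(1) refl, of k] p(2)[of k] by auto
    qed
    with p(1) show "x \<in> (\<Union>p\<in>rt_paths CARD('n) D. path_box pos D p)" by blast
  qed
qed

end

theory Submission
  imports Defs
begin

text \<open>The diagram enumerates all ways of choosing one sub-interval per coordinate, merging
  partial choices of equal cost and discarding those of total cost above \<open>\<beta>\<close>. The cost of a
  sub-interval is a lower bound for the component function on it, because that function grows with
  the distance from 0 on either side (\<open>interval_cost_le\<close>). So if \<open>x\<close> is feasible and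
  one picks, for each coordinate, a sub-interval that contains that coordinate of \<open>x\<close>, the total
  cost is at most \<open>\<eta> x \<le> \<beta>\<close>: this choice survives as an r-t path
  (\<open>choice_path_in_rt_paths\<close>), and the box of that path contains \<open>x\<close>. Thus the feasible
  set lies in the union of the boxes, and taking convex hulls gives the claim.\<close>

text \<open>An infinite endpoint is never evaluated: a nonpositive upper endpoint lies between \<open>x\<close> and
  0, and so does a nonnegative lower endpoint, so both are real. Monotonicity of the component
  between that endpoint and \<open>x\<close> then gives the bound.\<close>

lemma interval_cost_le:
  assumes h: "scale_component h" and x: "x \<in> real_interval l u"
  shows "interval_cost h l u \<le> h x"
proof -
  have lx: "l \<le> ereal x" and xu: "ereal x \<le> u"
    using x by (auto simp: real_interval_def)
  consider "u \<le> 0" | "\<not> u \<le> 0" "0 \<le> l" | "\<not> u \<le> 0" "\<not> 0 \<le> l" by blast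
  then show ?thesis
  proof cases
    case 1
    then obtain b where "u = ereal b" "x \<le> b" "b \<le> 0"
      using xu by (cases u) auto
    then show ?thesis
      using h by (simp add: interval_cost_def scale_component_def)
  next
    case 2
    then obtain a where "l = ereal a" "0 \<le> a" "a \<le> x"
      using lx by (cases l) auto
    then show ?thesis
      using h 2 by (simp add: interval_cost_def scale_component_def)
  next
    case 3
    then show ?thesis
      using h by (simp add: interval_cost_def scale_component_def)
  qed
qed

lemma reached_choice_sum:
  assumes "1 \<le> i" and "\<And>m. m \<in> {1..<i} \<Longrightarrow> j m \<in> L m"
  shows "reached L c i (\<Sum>m = 1..<i. c m (j m))"
  using assms
proof (induction i rule: dec_induct)
  case base
  then show ?case using reached.root[of L c] by simp
next
  case (step i)
  then show ?case using reached.step[of L c i _ "j i"] by simp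
qed

text \<open>Of each pair of parallel arcs the path uses the lower one; its box does not depend on
  that.\<close>

definition choice_path :: "nat \<Rightarrow> (nat \<Rightarrow> 'j \<Rightarrow> real) \<Rightarrow> (nat \<Rightarrow> 'j) \<Rightarrow> nat \<Rightarrow> 'j arc"
  where "choice_path n c j =
    (\<lambda>i\<in>{1..n}. Arc (State i (\<Sum>m = 1..<i. c m (j m))) (j i) Lower)"

text \<open>The state value of a node is the cost accumulated so far, so merging nodes of equal state
  value loses no choice, and the test against \<open>\<beta>\<close> in the last layer concerns exactly the total
  cost of the choice.\<close>

lemma choice_path_in_rt_paths:
  fixes h :: "nat \<Rightarrow> real \<Rightarrow> real" and lo up :: "nat \<Rightarrow> 'j \<Rightarrow> ereal"
  defines "c \<equiv> \<lambda>i j. interval_cost (h i) (lo i j) (up i j)"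
  assumes j: "\<And>i. i \<in> {1..n} \<Longrightarrow> j i \<in> L i"
    and cost: "(\<Sum>i = 1..n. c i (j i)) \<le> \<beta>"
  shows "choice_path n c j \<in> rt_paths n (build_diagram n h \<beta> L lo up)"
proof -
  have "reached L c i (\<Sum>m = 1..<i. c m (j m))" if "i \<in> {1..n}" for i
    using that j by (intro reached_choice_sum) auto
  moreover have "(\<Sum>m = 1..<n. c m (j m)) + c n (j n) \<le> \<beta>" if "1 \<le> n"
    using that cost by (simp add: sum.last_plus add.commute)
  ultimately show ?thesis
    using j by (auto simp: choice_path_def rt_paths_def build_diagram_def Let_def c_def)
qed

lemma path_box_choice_path:
  fixes pos :: "'n::finite \<Rightarrow> nat"
  assumes "\<And>k. pos k \<in> {1..n}"
  shows "path_box pos (build_diagram n h \<beta> L lo up) (choice_path n c j) =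
    {x. \<forall>k. x $ k \<in> real_interval (lo (pos k) (j (pos k))) (up (pos k) (j (pos k)))}"
  using assms by (simp add: path_box_def choice_path_def build_diagram_def Let_def)

theorem proposition3:
  fixes pos :: "'n::finite \<Rightarrow> nat"
    and \<eta> :: "real^'n \<Rightarrow> real"
    and h :: "nat \<Rightarrow> real \<Rightarrow> real"
    and \<beta> :: real
    and l u :: "nat \<Rightarrow> ereal"
    and L :: "nat \<Rightarrow> 'j set"
    and lo up :: "nat \<Rightarrow> 'j \<Rightarrow> ereal"
  assumes "bij_betw pos UNIV {1..CARD('n)}"
    and "scale_function pos h \<eta>"
    and "\<And>i. i \<in> {1..CARD('n)} \<Longrightarrow> proper_interval (l i) (u i)"
    and "\<And>i j. i \<in> {1..CARD('n)} \<Longrightarrow> j \<in> L i \<Longrightarrow> proper_interval (lo i j) (up i j)"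
    and "\<And>i. i \<in> {1..CARD('n)} \<Longrightarrow>
           (\<Union>j\<in>L i. real_interval (lo i j) (up i j)) = real_interval (l i) (u i)"
  shows "convex hull (feasible_set pos \<eta> \<beta> l u)
           \<subseteq> conv_Sol pos (build_diagram CARD('n) h \<beta> L lo up)"
  unfolding conv_Sol_def
proof (rule hull_mono, rule subsetI)
  let ?n = "CARD('n)"
  let ?D = "build_diagram ?n h \<beta> L lo up"
  let ?c = "\<lambda>i j. interval_cost (h i) (lo i j) (up i j)"
  fix x assume x: "x \<in> feasible_set pos \<eta> \<beta> l u"
  have rng: "pos k \<in> {1..?n}" for k
    using assms(1) by (auto simp: bij_betw_def)
  define y where "y i = x $ inv pos i" for i
  have y_pos: "y (pos k) = x $ k" for k
    using assms(1) by (simp add: y_def bij_betw_def)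
  have "\<exists>j\<in>L i. y i \<in> real_interval (lo i j) (up i j)" if i: "i \<in> {1..?n}" for i
  proof -
    obtain k where "i = pos k"
      using i assms(1) by (metis bij_betw_imp_surj_on imageE)
    then have "y i \<in> real_interval (l i) (u i)"
      using x by (simp add: feasible_set_def y_pos)
    then show ?thesis using assms(5)[OF i] by blast
  qed
  then obtain j where j: "\<And>i. i \<in> {1..?n} \<Longrightarrow> j i \<in> L i"
      "\<And>i. i \<in> {1..?n} \<Longrightarrow> y i \<in> real_interval (lo i (j i)) (up i (j i))"
    by metis
  have "(\<Sum>i = 1..?n. ?c i (j i)) \<le> (\<Sum>i = 1..?n. h i (y i))"
    using assms(2) j(2) by (intro sum_mono interval_cost_le) (auto simp: scale_function_def)
  also have "\<dots> = \<eta> x"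
    using assms(2) sum.reindex_bij_betw[OF assms(1), of "\<lambda>i. h i (y i)"]
    by (simp add: y_pos scale_function_def)
  also have "\<dots> \<le> \<beta>"
    using x by (simp add: feasible_set_def)
  finally have "choice_path ?n ?c j \<in> rt_paths ?n ?D"
    by (intro choice_path_in_rt_paths j(1))
  moreover have "x \<in> path_box pos ?D (choice_path ?n ?c j)"
    using j(2)[OF rng] by (simp add: path_box_choice_path[OF rng] y_pos)
  ultimately show "x \<in> (\<Union>p\<in>rt_paths ?n ?D. path_box pos ?D p)"
    by blast
qed

end
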